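(* Let $p\in\mathbb R$, $y\in\mathcal S_p$, $\sigma_{ij},b_i\in\mathcal S_{-p}$ for $i,j=1,\dots,d$, and $x\in\mathbb R^d$. Put $\bar\sigma_{ij}(r):=\langle\sigma_{ij},\tau_r y\rangle$ and $\bar b_i(r):=\langle b_i,\tau_r y\rangle$ for $r\in\mathbb R^d$ (i.e. $\bar\sigma_{ij}=\sigma_{ij}\star\tilde y$, $\bar b_i=b_i\star\tilde y$). Let $(Y_t(\tau_x(y)),\eta)$ be an $\hat{\mathcal S}_p$-valued strong (local) solution of $dY_t=A(Y_t)\cdot dB_t+L(Y_t)\,dt$ with initial condition $Y_0=\tau_x(y)$, and let $$z_t(\tau_x(y)):=\int_0^{t}\langle\sigma,Y_s(\tau_x(y))\rangle\cdot dB_s+\int_0^{t}\langle b,Y_s(\tau_x(y))\rangle\,ds,\qquad 0\le t<\eta,$$ so that almost surely $Y_t(\tau_x(y))=\tau_{z_t(\tau_x(y))}(\tau_x(y))=\tau_{x+z_t(\tau_x(y))}(y)$ for $t<\eta$. Then the process $X_t:=x+z_t(\tau_x(y))$ solves the finite-dimensional equation with coefficients $\bar\sigma,\bar b$ and initial condition $x$ up to the random time $\eta$; that is, almost surely, $$X_t=x+\int_0^t\bar\sigma(X_s)\cdot dB_s+\int_0^t\bar b(X_s)\,ds,\qquad 0\le t<\eta .$$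
   Context: $(\Omega,\mathcal F,(\mathcal F_t)_{t\ge0},P)$ is a filtered probability space satisfying the usual conditions, $(B_t)=(B^1_t,\dots,B^d_t)$ is a standard $d$-dimensional $(\mathcal F_t)$-Brownian motion on it, and $(\mathcal F^B_t)$ is the filtration generated by $(B_t)$, augmented by the $P$-null sets. $\mathcal S$ is the Schwartz space of real rapidly decreasing functions on $\mathbb R^d$ and $\mathcal S'$ the space of tempered distributions. With $\{h_k:k\in\mathbb Z_+^d\}$ the orthonormal basis of Hermite functions in $L^2(\mathbb R^d,dx)$ (inner product $\langle\cdot,\cdot\rangle_0$), for $p\in\mathbb R$ and $f,g\in\mathcal S$ put $\langle f,g\rangle_p:=\sum_{k}(2|k|+d)^{2p}\langle f,h_k\rangle_0\langle g,h_k\rangle_0$, $|k|=k_1+\dots+k_d$, and let $\mathcal S_p$ be the Hilbert space completion of $\mathcal S$ in the norm $\|\cdot\|_p$. $\mathcal S_{-p}$ is identified with the dual of $\mathcal S_p$, and $\langle\cdot,\cdot\rangle$ denotes this duality. For $x\in\mathbb R^d$ the translation $\tau_x$ is $\tau_xf(r)=f(r-x)$ on $\mathcal S$ and $\langle\tau_x\phi,f\rangle:=\langle\phi,\tau_{-x}f\rangle$ on $\mathcal S'$; it maps $\mathcal S_p$ boundedly to $\mathcal S_p$. The derivatives $\partial_i:\mathcal S_p\to\mathcal S_{p-1/2}$ are bounded. $\tilde y$ is the reflected distribution $\langle\tilde y,f\rangle=\langle y,f(-\cdot)\rangle$. For $\sigma_{ij},b_i\in\mathcal S_{-p}$ and $\phi\in\mathcal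 S_p$, $\langle\sigma,\phi\rangle$ is the matrix with entries $\langle\sigma,\phi\rangle_{ij}=\langle\sigma_{ij},\phi\rangle$, $\langle b,\phi\rangle$ the vector with entries $\langle b,\phi\rangle_i=\langle b_i,\phi\rangle$; for a matrix process $M$, $(M\cdot dB)_i=\sum_jM_{ij}dB^j$. The nonlinear operators $A=(A_1,\dots,A_d)$ and $L$, from $\mathcal S_p$ to $\mathcal S_{p-1}$, are $$A_j\phi=-\sum_{i=1}^d\langle\sigma,\phi\rangle_{ij}\,\partial_i\phi,\qquad L\phi=\tfrac12\sum_{i,j=1}^d(\langle\sigma,\phi\rangle\langle\sigma,\phi\rangle^t)_{ij}\,\partial^2_{ij}\phi-\sum_{i=1}^d\langle b,\phi\rangle_i\,\partial_i\phi .$$ $\hat{\mathcal S}_p:=\mathcal S_p\cup\{\delta\}$ with $\delta$ an isolated point. An $\hat{\mathcal S}_p$-valued strong (local) solution of $dY_t=A(Y_t)\cdot dB_t+L(Y_t)dt$, $Y_0=y_0\in\mathcal S_p$, is a pair $(Y_t(y_0),\eta)$ where $\eta:\Omega\to(0,\infty]$ is an $(\mathcal F^B_t)$-stopping time and $(Y_t(y_0))$ is an $\hat{\mathcal S}_p$-valued $(\mathcal F^B_t)$-adapted process such that: (1) for all $\omega$, $t\mapsto Y_t(y_0,\omega)$ is continuous from $[0,\eta(\omega))$ to $\mathcal S_p$ and $Y_t(y_0,\omega)=\delta$ for $t\ge\eta(\omega)$; (2) almost surely, in $\mathcal S_{p-1}$, for $0\le t<\eta(\omega)$, $$Y_t(y_0)=y_0+\sum_{j=1}^d\int_0^tA_j(Y_s(y_0))\,dB^j_s+\int_0^tL(Y_s(y_0))\,ds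 .$$ The identity $Y_t(\tau_x(y))=\tau_{z_t(\tau_x(y))}(\tau_x(y))$ a.s. for $t<\eta$ holds for every strong solution and may be taken as given. *)

theory Defs
  imports "HOL-Probability.Probability"
begin

section \<open>Schwartz functions\<close>

definition partial :: "'n::finite \<Rightarrow> (real^'n \<Rightarrow> real) \<Rightarrow> real^'n \<Rightarrow> real" where
  "partial i f x = frechet_derivative f (at x) (axis i 1)"

text \<open>Iterated partial derivatives are indexed by lists of directions, so no symmetry of mixed
  derivatives is needed.  Requiring differentiability of all of them amounts to smoothness.\<close>

abbreviation partials :: "'n::finite list \<Rightarrow> (real^'n \<Rightarrow> real) \<Rightarrow> real^'n \<Rightarrow> real" where
  "partials is f \<equiv> foldr partial is f"

definition rapidly_decreasing :: "(real^'n::finite \<Rightarrow> real) \<Rightarrow> bool" where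
  "rapidly_decreasing f \<longleftrightarrow>
     (\<forall>is. (\<forall>x. partials is f differentiable at x) \<and>
           (\<forall>N. bounded (range (\<lambda>x. (1 + norm x)^N * partials is f x))))"

lemma partial_eqI:
  "(f has_derivative f') (at x) \<Longrightarrow> partial i f x = f' (axis i 1)"
  by (simp add: partial_def frechet_derivative_at[symmetric])

lemma partials_zero: "partials is (\<lambda>x. 0) = (\<lambda>x. 0)"
  by (induction "is") (auto simp: partial_def)

lemma partial_add:
  assumes "\<And>x. f differentiable at x" "\<And>x. g differentiable at x"
  shows "partial i (\<lambda>x. f x + g x) = (\<lambda>x. partial i f x + partial i g x)"
proof
  fix x
  have "((\<lambda>x. f x + g x) has_derivative
      (\<lambda>h. frechet_derivative f (at x) h + frechet_derivative g (at x) h)) (at x)"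
    using assms by (intro has_derivative_add) (auto simp: frechet_derivative_works[symmetric])
  from partial_eqI[OF this] show "partial i (\<lambda>x. f x + g x) x = partial i f x + partial i g x"
    by (simp add: partial_def)
qed

lemma partial_scale:
  assumes "\<And>x. f differentiable at x"
  shows "partial i (\<lambda>x. c * f x) = (\<lambda>x. c * partial i f x)"
proof
  fix x
  have "((\<lambda>x. c * f x) has_derivative (\<lambda>h. c * frechet_derivative f (at x) h)) (at x)"
    using assms
    by (intro has_derivative_mult_right) (auto simp: frechet_derivative_works[symmetric])
  from partial_eqI[OF this] show "partial i (\<lambda>x. c * f x) x = c * partial i f x"
    by (simp add: partial_def)
qed

lemma differentiable_shift:
  fixes f :: "real^'n::finite \<Rightarrow> real"
  assumes "\<And>x. f differentiable at x"
  shows "(\<lambda>x. f (x - a)) differentiable at x"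
proof -
  have "(f \<circ> (\<lambda>x. x - a)) differentiable at x"
    using assms by (intro differentiable_chain_at) auto
  then show ?thesis by (simp add: o_def)
qed

lemma partial_shift:
  assumes "\<And>x. f differentiable at x"
  shows "partial i (\<lambda>x. f (x - a)) = (\<lambda>x. partial i f (x - a))"
proof
  fix x
  have *: "(f has_derivative frechet_derivative f (at (x - a))) (at (x - a))"
    using assms frechet_derivative_works by blast
  have "((\<lambda>x. x - a) has_derivative (\<lambda>h. h)) (at x)"
    by (auto intro!: derivative_eq_intros)
  from has_derivative_compose[OF this *]
  have "((\<lambda>x. f (x - a)) has_derivative frechet_derivative f (at (x - a))) (at x)" .
  from partial_eqI[OF this] show "partial i (\<lambda>x. f (x - a)) x = partial i f (x - a)"
    by (simp add: partial_def)
qed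

lemma partials_add:
  assumes "rapidly_decreasing f" "rapidly_decreasing g"
  shows "partials is (\<lambda>x. f x + g x) = (\<lambda>x. partials is f x + partials is g x)"
  using assms by (induction "is") (auto simp: rapidly_decreasing_def intro!: partial_add)

lemma partials_scale:
  assumes "rapidly_decreasing f"
  shows "partials is (\<lambda>x. c * f x) = (\<lambda>x. c * partials is f x)"
  using assms by (induction "is") (auto simp: rapidly_decreasing_def intro!: partial_scale)

lemma partials_shift:
  assumes "rapidly_decreasing f"
  shows "partials is (\<lambda>x. f (x - a)) = (\<lambda>x. partials is f (x - a))"
  using assms by (induction "is") (auto simp: rapidly_decreasing_def intro!: partial_shift)

lemma rapidly_decreasing_zero: "rapidly_decreasing (\<lambda>x. 0)"
  by (auto simp: rapidly_decreasing_def partials_zero)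

lemma rapidly_decreasing_add:
  assumes "rapidly_decreasing f" "rapidly_decreasing g"
  shows "rapidly_decreasing (\<lambda>x. f x + g x)"
  unfolding rapidly_decreasing_def partials_add[OF assms]
  using assms
  by (auto simp: rapidly_decreasing_def distrib_left intro!: bounded_plus_comp)

lemma rapidly_decreasing_scale:
  assumes "rapidly_decreasing f"
  shows "rapidly_decreasing (\<lambda>x. c * f x)"
proof -
  have "bounded (range (\<lambda>x. (1 + norm x)^N * (c * partials is f x)))" for "is" N
  proof -
    have "bounded ((\<lambda>y. c *\<^sub>R y) ` range (\<lambda>x. (1 + norm x)^N * partials is f x))"
      using assms by (intro bounded_scaling) (auto simp: rapidly_decreasing_def)
    then show ?thesis by (simp add: image_image mult_ac)
  qed
  then show ?thesis
    unfolding rapidly_decreasing_def partials_scale[OF assms]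
    using assms by (auto simp: rapidly_decreasing_def)
qed

lemma weight_shift:
  fixes x a :: "'a::real_normed_vector"
  shows "(1 + norm x)^N \<le> (1 + norm a)^N * (1 + norm (x - a))^N"
proof -
  have "norm x \<le> norm a + norm (x - a)"
    using norm_triangle_ineq[of a "x - a"] by simp
  moreover have "0 \<le> norm a * norm (x - a)" by simp
  moreover have "(1 + norm a) * (1 + norm (x - a)) =
      1 + norm a + norm (x - a) + norm a * norm (x - a)"
    by (simp add: algebra_simps)
  ultimately have "1 + norm x \<le> (1 + norm a) * (1 + norm (x - a))"
    by linarith
  then have "(1 + norm x)^N \<le> ((1 + norm a) * (1 + norm (x - a)))^N"
    by (intro power_mono) auto
  then show ?thesis by (simp add: power_mult_distrib)
qed

lemma weighted_shift:
  fixes g :: "'a::real_normed_vector \<Rightarrow> real"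
  shows "\<bar>(1 + norm x)^N * g (x - a)\<bar>
    \<le> (1 + norm a)^N * \<bar>(1 + norm (x - a))^N * g (x - a)\<bar>"
  using mult_right_mono[OF weight_shift[of x N a] abs_ge_zero[of "g (x - a)"]]
  by (simp add: abs_mult mult.assoc)

lemma rapidly_decreasing_shift:
  assumes "rapidly_decreasing f"
  shows "rapidly_decreasing (\<lambda>x. f (x - a))"
proof -
  have "bounded (range (\<lambda>x. (1 + norm x)^N * partials is f (x - a)))" for "is" N
  proof -
    obtain C where C: "\<And>x. \<bar>(1 + norm x)^N * partials is f x\<bar> \<le> C"
      using assms by (force simp: rapidly_decreasing_def bounded_iff)
    have "\<bar>(1 + norm x)^N * partials is f (x - a)\<bar> \<le> (1 + norm a)^N * C" for x
      by (rule order_trans[OF weighted_shift]) (intro mult_left_mono C, auto)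
    then show ?thesis by (auto simp: bounded_iff)
  qed
  then show ?thesis
    unfolding rapidly_decreasing_def partials_shift[OF assms]
    using assms by (auto simp: rapidly_decreasing_def intro!: differentiable_shift)
qed

lemma rapidly_decreasing_partial:
  assumes "rapidly_decreasing f"
  shows "rapidly_decreasing (partial i f)"
proof -
  have *: "partials is (partial i f) = partials (is @ [i]) f" for "is" by simp
  show ?thesis
    using assms unfolding rapidly_decreasing_def * by blast
qed

typedef (overloaded) ('n::finite) schwartz = "{f :: real^'n \<Rightarrow> real. rapidly_decreasing f}"
  morphisms fun_of Abs_schwartz
  using rapidly_decreasing_zero by blast

setup_lifting type_definition_schwartz

instantiation schwartz :: (finite) real_vector
begin

lift_definition zero_schwartz :: "'a schwartz" is "\<lambda>x. 0"
  by (rule rapidly_decreasing_zero)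

lift_definition plus_schwartz :: "'a schwartz \<Rightarrow> 'a schwartz \<Rightarrow> 'a schwartz"
  is "\<lambda>f g x. f x + g x"
  by (rule rapidly_decreasing_add)

lift_definition uminus_schwartz :: "'a schwartz \<Rightarrow> 'a schwartz" is "\<lambda>f x. - f x"
  using rapidly_decreasing_scale[where c = "- 1"] by simp

lift_definition minus_schwartz :: "'a schwartz \<Rightarrow> 'a schwartz \<Rightarrow> 'a schwartz"
  is "\<lambda>f g x. f x - g x"
  using rapidly_decreasing_add[OF _ rapidly_decreasing_scale[where c = "- 1"]] by simp

lift_definition scaleR_schwartz :: "real \<Rightarrow> 'a schwartz \<Rightarrow> 'a schwartz" is "\<lambda>c f x. c * f x"
  by (rule rapidly_decreasing_scale)

instance
  by standard (transfer; simp add: fun_eq_iff algebra_simps)+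

end

lift_definition translate_schwartz :: "real^'n::finite \<Rightarrow> 'n schwartz \<Rightarrow> 'n schwartz"
  is "\<lambda>x f r. f (r - x)"
  by (rule rapidly_decreasing_shift)

lift_definition partial_schwartz :: "'n::finite \<Rightarrow> 'n schwartz \<Rightarrow> 'n schwartz" is partial
  by (rule rapidly_decreasing_partial)


section \<open>Tempered distributions\<close>

definition schwartz_null :: "(nat \<Rightarrow> 'n::finite schwartz) \<Rightarrow> bool" where
  "schwartz_null f \<longleftrightarrow>
     (\<forall>is N. uniform_limit UNIV (\<lambda>n x. (1 + norm x)^N * partials is (fun_of (f n)) x) (\<lambda>_. 0)
        sequentially)"

text \<open>The Schwartz topology is metrizable, so for linear maps sequential continuity at the origin is continuity.\<close>

typedef (overloaded) ('n::finite) tempered =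
  "{\<phi> :: 'n schwartz \<Rightarrow> real. linear \<phi> \<and> (\<forall>f. schwartz_null f \<longrightarrow> (\<lambda>n. \<phi> (f n)) \<longlonglongrightarrow> 0)}"
  morphisms pair Abs_tempered
  by (rule exI[of _ "\<lambda>_. 0"]) (auto simp: linear_iff)

setup_lifting type_definition_tempered

instantiation tempered :: (finite) real_vector
begin

lift_definition zero_tempered :: "'a tempered" is "\<lambda>f. 0"
  by (auto simp: linear_iff)

lift_definition plus_tempered :: "'a tempered \<Rightarrow> 'a tempered \<Rightarrow> 'a tempered"
  is "\<lambda>\<phi> \<psi> f. \<phi> f + \<psi> f"
  by (auto simp: linear_iff algebra_simps intro!: tendsto_add_zero)

lift_definition uminus_tempered :: "'a tempered \<Rightarrow> 'a tempered" is "\<lambda>\<phi> f. - \<phi> f"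
  by (auto simp: linear_iff algebra_simps tendsto_minus_cancel_left[symmetric])

lift_definition minus_tempered :: "'a tempered \<Rightarrow> 'a tempered \<Rightarrow> 'a tempered"
  is "\<lambda>\<phi> \<psi> f. \<phi> f - \<psi> f"
proof (intro conjI allI impI; elim conjE)
  fix \<phi> \<psi> :: "'a schwartz \<Rightarrow> real"
  assume \<phi>: "linear \<phi>" "\<forall>f. schwartz_null f \<longrightarrow> (\<lambda>n. \<phi> (f n)) \<longlonglongrightarrow> 0"
    and \<psi>: "linear \<psi>" "\<forall>f. schwartz_null f \<longrightarrow> (\<lambda>n. \<psi> (f n)) \<longlonglongrightarrow> 0"
  show "linear (\<lambda>f. \<phi> f - \<psi> f)" using \<phi>(1) \<psi>(1) by (rule linear_compose_sub)
  fix f :: "nat \<Rightarrow> 'a schwartz" assume "schwartz_null f"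
  then have "(\<lambda>n. \<phi> (f n)) \<longlonglongrightarrow> 0" "(\<lambda>n. \<psi> (f n)) \<longlonglongrightarrow> 0" using \<phi>(2) \<psi>(2) by auto
  from tendsto_diff[OF this] show "(\<lambda>n. \<phi> (f n) - \<psi> (f n)) \<longlonglongrightarrow> 0" by simp
qed

lift_definition scaleR_tempered :: "real \<Rightarrow> 'a tempered \<Rightarrow> 'a tempered"
  is "\<lambda>c \<phi> f. c * \<phi> f"
  by (auto simp: linear_iff algebra_simps intro!: tendsto_mult_right_zero)

instance
  by standard (transfer; simp add: fun_eq_iff algebra_simps)+

end

lemma schwartz_null_translate:
  assumes "schwartz_null f"
  shows "schwartz_null (\<lambda>n. translate_schwartz a (f n))"
  unfolding schwartz_null_def
proof (intro allI uniform_limitI)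
  fix "is" N and e :: real assume "e > 0"
  let ?g = "\<lambda>n x. partials is (fun_of (f n)) x"
  have pos: "(1 + norm a)^N > 0" by (intro zero_less_power) (simp add: add_pos_nonneg)
  have "uniform_limit UNIV (\<lambda>n x. (1 + norm x)^N * ?g n x) (\<lambda>_. 0) sequentially"
    using assms by (simp add: schwartz_null_def)
  from uniform_limitD[OF this, of "e / (1 + norm a)^N"] \<open>e > 0\<close> pos
  have "\<forall>\<^sub>F n in sequentially. \<forall>x. \<bar>(1 + norm x)^N * ?g n x\<bar> < e / (1 + norm a)^N"
    by simp
  then show "\<forall>\<^sub>F n in sequentially. \<forall>x\<in>UNIV.
      dist ((1 + norm x)^N * partials is (fun_of (translate_schwartz a (f n))) x) 0 < e"
  proof (rule eventually_mono, intro ballI)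
    fix n x assume *: "\<forall>x. \<bar>(1 + norm x)^N * ?g n x\<bar> < e / (1 + norm a)^N"
    have "rapidly_decreasing (fun_of (f n))" using fun_of by blast
    then have "partials is (fun_of (translate_schwartz a (f n))) x = ?g n (x - a)"
      by (simp add: translate_schwartz.rep_eq partials_shift)
    moreover have "\<bar>(1 + norm x)^N * ?g n (x - a)\<bar> < e"
    proof (rule le_less_trans[OF weighted_shift])
      have "\<bar>(1 + norm (x - a))^N * ?g n (x - a)\<bar> < e / (1 + norm a)^N" using * by blast
      then show "(1 + norm a)^N * \<bar>(1 + norm (x - a))^N * ?g n (x - a)\<bar> < e"
        using pos by (simp add: pos_less_divide_eq mult.commute)
    qed
    ultimately show
      "dist ((1 + norm x)^N * partials is (fun_of (translate_schwartz a (f n))) x) 0 < e"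
      by simp
  qed
qed

lemma linear_translate_schwartz: "linear (translate_schwartz a)"
  by (rule linearI; transfer; simp)

lemma schwartz_null_partial:
  assumes "schwartz_null f"
  shows "schwartz_null (\<lambda>n. partial_schwartz i (f n))"
proof -
  have *: "partials is (fun_of (partial_schwartz i (f n))) = partials (is @ [i]) (fun_of (f n))"
    for "is" n
    by (simp add: partial_schwartz.rep_eq)
  show ?thesis using assms unfolding schwartz_null_def * by blast
qed

lemma linear_partial_schwartz: "linear (partial_schwartz i)"
proof (rule linearI; transfer)
  show "partial i (\<lambda>x. f x + g x) = (\<lambda>x. partial i f x + partial i g x)"
    if "rapidly_decreasing f" "rapidly_decreasing g" for i f g
    using partials_add[OF that, of "[i]"] by simp
  show "partial i (\<lambda>x. c * f x) = (\<lambda>x. c * partial i f x)"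
    if "rapidly_decreasing f" for i c f
    using partials_scale[OF that, of "[i]"] by simp
qed

lift_definition translate :: "real^'n::finite \<Rightarrow> 'n tempered \<Rightarrow> 'n tempered"
  is "\<lambda>x \<phi> f. \<phi> (translate_schwartz (- x) f)"
proof (intro conjI allI impI; elim conjE)
  fix x :: "real^'n" and \<phi> :: "'n schwartz \<Rightarrow> real"
  assume \<phi>: "linear \<phi>" "\<forall>f. schwartz_null f \<longrightarrow> (\<lambda>n. \<phi> (f n)) \<longlonglongrightarrow> 0"
  show "linear (\<lambda>f. \<phi> (translate_schwartz (- x) f))"
    using linear_compose[OF linear_translate_schwartz \<phi>(1)] by (simp add: o_def)
  fix f :: "nat \<Rightarrow> 'n schwartz" assume "schwartz_null f"
  then show "(\<lambda>n. \<phi> (translate_schwartz (- x) (f n))) \<longlonglongrightarrow> 0"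
    using \<phi>(2) schwartz_null_translate by blast
qed

lift_definition deriv_tempered :: "'n::finite \<Rightarrow> 'n tempered \<Rightarrow> 'n tempered"
  is "\<lambda>i \<phi> f. - \<phi> (partial_schwartz i f)"
proof (intro conjI allI impI; elim conjE)
  fix i :: 'n and \<phi> :: "'n schwartz \<Rightarrow> real"
  assume \<phi>: "linear \<phi>" "\<forall>f. schwartz_null f \<longrightarrow> (\<lambda>n. \<phi> (f n)) \<longlonglongrightarrow> 0"
  show "linear (\<lambda>f. - \<phi> (partial_schwartz i f))"
    using linear_compose_neg[OF linear_compose[OF linear_partial_schwartz \<phi>(1)]]
    by (simp add: o_def)
  fix f :: "nat \<Rightarrow> 'n schwartz" assume "schwartz_null f"
  then have "(\<lambda>n. \<phi> (partial_schwartz i (f n))) \<longlonglongrightarrow> 0"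
    using \<phi>(2) schwartz_null_partial by blast
  from tendsto_minus[OF this] show "(\<lambda>n. - \<phi> (partial_schwartz i (f n))) \<longlonglongrightarrow> 0" by simp
qed

lemma translate_translate: "translate a (translate b \<phi>) = translate (a + b) \<phi>"
proof -
  have "translate_schwartz (- b) (translate_schwartz (- a) f) = translate_schwartz (- (a + b)) f"
    for f :: "'a schwartz"
    by transfer (simp add: algebra_simps)
  then show ?thesis by transfer simp
qed


section \<open>Hermite functions\<close>

primrec hermite_poly :: "nat \<Rightarrow> real poly" where
  "hermite_poly 0 = 1"
| "hermite_poly (Suc n) = [:0, 2:] * hermite_poly n - pderiv (hermite_poly n)"

definition hermite_fun :: "nat \<Rightarrow> real \<Rightarrow> real" where
  "hermite_fun n x = poly (hermite_poly n) x * exp (- x\<^sup>2 / 2) / sqrt (2^n * fact n * sqrt pi)"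

text \<open>The span of the polynomial multiples of the Gaussian, closed under \<^const>\<open>partial\<close>.\<close>

inductive poly_gauss :: "(real^'n::finite \<Rightarrow> real) \<Rightarrow> bool" where
  gauss: "poly_gauss (\<lambda>x. exp (- (x \<bullet> x) / 2))"
| coord: "poly_gauss f \<Longrightarrow> poly_gauss (\<lambda>x. x $ i * f x)"
| add: "poly_gauss f \<Longrightarrow> poly_gauss g \<Longrightarrow> poly_gauss (\<lambda>x. f x + g x)"
| scale: "poly_gauss f \<Longrightarrow> poly_gauss (\<lambda>x. c * f x)"

lemma poly_gauss_derivative:
  fixes f :: "real^'n::finite \<Rightarrow> real"
  assumes "poly_gauss f"
  shows "(\<forall>x. f differentiable at x) \<and> poly_gauss (partial i f)"
  using assms
proof induction
  case gauss
  have d: "((\<lambda>x. exp (- (x \<bullet> x) / 2)) has_derivative (\<lambda>h. - (x \<bullet> h) * exp (- (x \<bullet> x) / 2))) (at x)"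
    for x :: "real^'n"
    by (auto intro!: derivative_eq_intros simp: inner_commute fun_eq_iff field_simps)
  have p: "partial i (\<lambda>x. exp (- (x \<bullet> x) / 2)) = (\<lambda>x. - 1 * (x $ i * exp (- (x \<bullet> x) / 2)))"
    by (rule ext, subst partial_eqI[OF d]) (simp add: inner_axis)
  show ?case
    unfolding p
  proof (intro conjI allI)
    show "(\<lambda>x. exp (- (x \<bullet> x) / 2)) differentiable at x" for x :: "real^'n"
      using d unfolding differentiable_def by blast
    show "poly_gauss (\<lambda>x::real^'n. - 1 * (x $ i * exp (- (x \<bullet> x) / 2)))"
      by (intro poly_gauss.intros)
  qed
next
  case (coord f j)
  have "(f has_derivative frechet_derivative f (at x)) (at x)" for x
    using coord.IH frechet_derivative_works by blast
  then have d: "((\<lambda>x. x $ j * f x) has_derivative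
      (\<lambda>h. x $ j * frechet_derivative f (at x) h + h $ j * f x)) (at x)" for x
    by (intro has_derivative_mult bounded_linear.has_derivative[OF bounded_linear_vec_nth])
       (auto intro: derivative_intros)
  have p: "partial i (\<lambda>x. x $ j * f x) =
      (\<lambda>x. x $ j * partial i f x + (if i = j then 1 else 0) * f x)"
    by (rule ext) (simp add: partial_eqI[OF d], simp add: partial_def axis_def)
  show ?case
    unfolding p
  proof (intro conjI allI)
    show "(\<lambda>x. x $ j * f x) differentiable at x" for x
      using d unfolding differentiable_def by blast
    show "poly_gauss (\<lambda>x. x $ j * partial i f x + (if i = j then 1 else 0) * f x)"
      using coord by (intro poly_gauss.add poly_gauss.coord poly_gauss.scale) auto
  qed
next
  case (add f g)
  then show ?case by (auto simp: partial_add intro: poly_gauss.intros)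
next
  case (scale f c)
  then show ?case by (auto simp: partial_scale intro: poly_gauss.intros)
qed

lemma poly_gauss_partials: "poly_gauss f \<Longrightarrow> poly_gauss (partials is f)"
  by (induction "is") (auto simp: poly_gauss_derivative)

lemma gauss_bounded: "\<exists>C. \<forall>r::real. 0 \<le> r \<longrightarrow> (1 + r)^N * exp (- (r * r) / 2) \<le> C"
proof (intro exI allI impI)
  fix r :: real assume r: "0 \<le> r"
  have "(1 + r)^N \<le> fact N * exp (1 + r)"
  proof -
    have sums: "(\<lambda>n. (1 + r)^n / fact n) sums exp (1 + r)"
      using exp_converges[of "1 + r"] by (simp add: divide_inverse mult.commute)
    have "sum (\<lambda>n. (1 + r)^n / fact n) {N} \<le> exp (1 + r)"
      unfolding sums_unique[OF sums]
      by (rule sum_le_suminf) (use r sums in \<open>auto simp: sums_iff\<close>)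
    then show ?thesis by (simp add: divide_simps mult.commute)
  qed
  then have "(1 + r)^N * exp (- (r * r) / 2) \<le> fact N * exp (1 + r) * exp (- (r * r) / 2)"
    by (intro mult_right_mono) auto
  also have "\<dots> = fact N * exp (1 + r - (r * r) / 2)"
    by (simp add: exp_add[symmetric])
  also have "\<dots> \<le> fact N * exp 2"
  proof -
    have "0 \<le> (r - 1) * (r - 1)" by simp
    then have "1 + r - (r * r) / 2 \<le> 2" by (simp add: algebra_simps)
    then show ?thesis by simp
  qed
  finally show "(1 + r)^N * exp (- (r * r) / 2) \<le> fact N * exp 2" .
qed

lemma poly_gauss_bounded:
  fixes f :: "real^'n::finite \<Rightarrow> real"
  assumes "poly_gauss f"
  shows "\<exists>C. \<forall>x. \<bar>(1 + norm x)^N * f x\<bar> \<le> C"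
  using assms
proof (induction arbitrary: N)
  case gauss
  obtain C where C: "\<And>r::real. 0 \<le> r \<Longrightarrow> (1 + r)^N * exp (- (r * r) / 2) \<le> C"
    using gauss_bounded by blast
  have "\<bar>(1 + norm x)^N * exp (- (x \<bullet> x) / 2)\<bar> \<le> C" for x :: "real^'n"
    using C[of "norm x"] by (simp add: abs_mult power2_norm_eq_inner[symmetric] power2_eq_square)
  then show ?case by blast
next
  case (coord f i)
  obtain C where C: "\<And>x. \<bar>(1 + norm x)^Suc N * f x\<bar> \<le> C" using coord.IH by blast
  have "\<bar>(1 + norm x)^N * (x $ i * f x)\<bar> \<le> C" for x
  proof -
    have "\<bar>x $ i\<bar> \<le> 1 + norm x" using component_le_norm_cart[of x i] by simp
    then have "\<bar>x $ i\<bar> * ((1 + norm x)^N * \<bar>f x\<bar>) \<le> (1 + norm x) * ((1 + norm x)^N * \<bar>f x\<bar>)"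
      by (intro mult_right_mono) auto
    then show ?thesis using C[of x] by (simp add: abs_mult mult_ac)
  qed
  then show ?case by blast
next
  case (add f g)
  obtain C D where "\<And>x. \<bar>(1 + norm x)^N * f x\<bar> \<le> C" "\<And>x. \<bar>(1 + norm x)^N * g x\<bar> \<le> D"
    using add.IH by metis
  then have "\<bar>(1 + norm x)^N * (f x + g x)\<bar> \<le> C + D" for x
    by (simp only: distrib_left) (meson abs_triangle_ineq add_mono order_trans)
  then show ?case by blast
next
  case (scale f c)
  obtain C where C: "\<And>x. \<bar>(1 + norm x)^N * f x\<bar> \<le> C" using scale.IH by blast
  have "\<bar>(1 + norm x)^N * (c * f x)\<bar> \<le> \<bar>c\<bar> * C" for x
    using mult_left_mono[OF C[of x] abs_ge_zero[of c]] by (simp add: abs_mult mult_ac)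
  then show ?case by blast
qed

lemma poly_gauss_rapidly_decreasing: "poly_gauss f \<Longrightarrow> rapidly_decreasing f"
  unfolding rapidly_decreasing_def
proof (intro allI conjI)
  fix "is" x N assume "poly_gauss f"
  then have *: "poly_gauss (partials is f)" by (rule poly_gauss_partials)
  then show "partials is f differentiable at x" using poly_gauss_derivative by blast
  show "bounded (range (\<lambda>x. (1 + norm x)^N * partials is f x))"
    using poly_gauss_bounded[OF *, of N] unfolding bounded_iff by (auto simp del: abs_mult)
qed

lemma poly_gauss_poly: "poly_gauss f \<Longrightarrow> poly_gauss (\<lambda>x. poly q (x $ i) * f x)"
proof (induction q)
  case 0
  then show ?case using poly_gauss.scale[of f 0] by simp
next
  case (pCons a q)
  then have "poly_gauss (\<lambda>x. a * f x + x $ i * (poly q (x $ i) * f x))"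
    by (intro poly_gauss.intros) auto
  then show ?case by (simp add: algebra_simps)
qed

lemma poly_gauss_prod:
  assumes "finite A"
  shows "poly_gauss (\<lambda>x. (\<Prod>i\<in>A. poly (q i) (x $ i)) * exp (- (x \<bullet> x) / 2))"
  using assms
proof induction
  case empty
  then show ?case using gauss by simp
next
  case (insert i A)
  then show ?case using poly_gauss_poly[OF insert.IH, of "q i" i] by (simp add: mult.assoc)
qed

lift_definition hermite :: "('n::finite \<Rightarrow> nat) \<Rightarrow> 'n schwartz"
  is "\<lambda>k x. \<Prod>i\<in>UNIV. hermite_fun (k i) (x $ i)"
proof -
  fix k :: "'n \<Rightarrow> nat"
  have "(\<Prod>i\<in>UNIV. hermite_fun (k i) (x $ i)) =
      (\<Prod>i\<in>UNIV. 1 / sqrt (2^k i * fact (k i) * sqrt pi)) *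
        ((\<Prod>i\<in>UNIV. poly (hermite_poly (k i)) (x $ i)) * exp (- (x \<bullet> x) / 2))"
    for x :: "real^'n"
  proof -
    have "- (x \<bullet> x) / 2 = (\<Sum>i\<in>UNIV. - (x $ i)\<^sup>2 / 2)"
      by (simp add: inner_vec_def sum_negf sum_divide_distrib power2_eq_square)
    then have "exp (- (x \<bullet> x) / 2) = (\<Prod>i\<in>UNIV. exp (- (x $ i)\<^sup>2 / 2))"
      by (simp only: exp_sum finite)
    then show ?thesis
      by (simp only: hermite_fun_def prod.distrib[symmetric]) (simp add: mult_ac)
  qed
  then show "rapidly_decreasing (\<lambda>x::real^'n. \<Prod>i\<in>UNIV. hermite_fun (k i) (x $ i))"
    by (simp only:) (intro poly_gauss_rapidly_decreasing poly_gauss.scale poly_gauss_prod, simp)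
qed


section \<open>The Hermite--Sobolev spaces\<close>

definition l2_inner :: "'n::finite schwartz \<Rightarrow> 'n schwartz \<Rightarrow> real" where
  "l2_inner f g = (LINT x|lborel. fun_of f x * fun_of g x)"

definition hs_inner :: "real \<Rightarrow> 'n::finite schwartz \<Rightarrow> 'n schwartz \<Rightarrow> real" where
  "hs_inner p f g =
     (\<Sum>\<^sub>\<infinity>k. (2 * real (\<Sum>i\<in>UNIV. k i) + real CARD('n)) powr (2 * p) *
        l2_inner f (hermite k) * l2_inner g (hermite k))"

definition hs_norm :: "real \<Rightarrow> 'n::finite schwartz \<Rightarrow> real" where
  "hs_norm p f = sqrt (hs_inner p f f)"

text \<open>The completion of the Schwartz space in \<^term>\<open>hs_norm p\<close> is realized inside the tempered
  distributions: a Cauchy sequence represents the distribution that is its limit in the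
  \<^term>\<open>l2_inner\<close> duality.  This limit exists for every Cauchy sequence, and two Cauchy sequences
  have the same limit iff their difference tends to zero in \<^term>\<open>hs_norm p\<close>.  The norm and the
  duality are then extended from the Schwartz space by continuity.\<close>

definition hs_represents :: "real \<Rightarrow> (nat \<Rightarrow> 'n::finite schwartz) \<Rightarrow> 'n tempered \<Rightarrow> bool" where
  "hs_represents p f \<phi> \<longleftrightarrow>
     (\<forall>e>0. \<exists>N. \<forall>m\<ge>N. \<forall>n\<ge>N. hs_norm p (f m - f n) < e) \<and>
     (\<forall>g. (\<lambda>n. l2_inner (f n) g) \<longlonglongrightarrow> pair \<phi> g)"

definition sobolev :: "real \<Rightarrow> 'n::finite tempered set" where
  "sobolev p = {\<phi>. \<exists>f. hs_represents p f \<phi>}"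

definition sobolev_norm :: "real \<Rightarrow> 'n::finite tempered \<Rightarrow> real" where
  "sobolev_norm p \<phi> = (THE c. \<forall>f. hs_represents p f \<phi> \<longrightarrow> (\<lambda>n. hs_norm p (f n)) \<longlonglongrightarrow> c)"

text \<open>For \<open>\<sigma> \<in> sobolev (- p)\<close> the functional \<^term>\<open>pair \<sigma>\<close> is bounded in \<^term>\<open>hs_norm p\<close>;
  the duality is its unique continuous extension to \<open>sobolev p\<close>.\<close>

definition duality :: "real \<Rightarrow> 'n::finite tempered \<Rightarrow> 'n tempered \<Rightarrow> real" where
  "duality p \<sigma> \<phi> = (THE c. \<forall>f. hs_represents p f \<phi> \<longrightarrow> (\<lambda>n. pair \<sigma> (f n)) \<longlonglongrightarrow> c)"

definition duality_mat ::
    "real \<Rightarrow> ('n::finite \<Rightarrow> 'n \<Rightarrow> 'n tempered) \<Rightarrow> 'n tempered \<Rightarrow> real^'n^'n" where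
  "duality_mat p \<sigma> \<phi> = (\<chi> i j. duality p (\<sigma> i j) \<phi>)"

definition duality_vec ::
    "real \<Rightarrow> ('n::finite \<Rightarrow> 'n tempered) \<Rightarrow> 'n tempered \<Rightarrow> real^'n" where
  "duality_vec p b \<phi> = (\<chi> i. duality p (b i) \<phi>)"

definition op_A ::
    "real \<Rightarrow> ('n::finite \<Rightarrow> 'n \<Rightarrow> 'n tempered) \<Rightarrow> 'n \<Rightarrow> 'n tempered \<Rightarrow> 'n tempered" where
  "op_A p \<sigma> j \<phi> = - (\<Sum>i\<in>UNIV. (duality_mat p \<sigma> \<phi> $ i $ j) *\<^sub>R deriv_tempered i \<phi>)"

definition op_L ::
    "real \<Rightarrow> ('n::finite \<Rightarrow> 'n \<Rightarrow> 'n tempered) \<Rightarrow> ('n \<Rightarrow> 'n tempered) \<Rightarrow> 'n tempered \<Rightarrow> 'n tempered"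
where
  "op_L p \<sigma> b \<phi> =
     (1 / 2) *\<^sub>R (\<Sum>i\<in>UNIV. \<Sum>j\<in>UNIV.
        ((duality_mat p \<sigma> \<phi> ** transpose (duality_mat p \<sigma> \<phi>)) $ i $ j) *\<^sub>R
          deriv_tempered i (deriv_tempered j \<phi>))
     - (\<Sum>i\<in>UNIV. (duality_vec p b \<phi> $ i) *\<^sub>R deriv_tempered i \<phi>)"


section \<open>Filtrations and Brownian motion\<close>

text \<open>Time is \<open>[0, \<infinity>)\<close>, encoded as the nonnegative reals; values at negative indices are
  irrelevant throughout.\<close>

definition usual_filtered_prob_space :: "'a measure \<Rightarrow> (real \<Rightarrow> 'a measure) \<Rightarrow> bool" where
  "usual_filtered_prob_space M F \<longleftrightarrow>
     prob_space M \<and> complete_measure M \<and>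
     (\<forall>t\<ge>0. subalgebra M (F t)) \<and>
     (\<forall>s t. 0 \<le> s \<and> s \<le> t \<longrightarrow> sets (F s) \<subseteq> sets (F t)) \<and>
     null_sets M \<subseteq> sets (F 0) \<and>
     (\<forall>t\<ge>0. sets (F t) = (\<Inter>u\<in>{t<..}. sets (F u)))"

definition standard_brownian_motion ::
    "'a measure \<Rightarrow> (real \<Rightarrow> 'a measure) \<Rightarrow> (real \<Rightarrow> 'a \<Rightarrow> real^'n::finite) \<Rightarrow> bool" where
  "standard_brownian_motion M F B \<longleftrightarrow>
     (\<forall>t\<ge>0. B t \<in> borel_measurable (F t)) \<and>
     (AE \<omega> in M. B 0 \<omega> = 0) \<and>
     (AE \<omega> in M. continuous_on {0..} (\<lambda>t. B t \<omega>)) \<and>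
     (\<forall>s t. 0 \<le> s \<and> s < t \<longrightarrow>
        distributed M lborel (\<lambda>\<omega>. B t \<omega> - B s \<omega>)
          (\<lambda>v. ennreal (\<Prod>i\<in>UNIV. normal_density 0 (sqrt (t - s)) (v $ i))) \<and>
        prob_space.indep_set M (sets (F s))
          {(\<lambda>\<omega>. B t \<omega> - B s \<omega>) -` C \<inter> space M | C. C \<in> sets borel})"

definition brownian_filtration ::
    "'a measure \<Rightarrow> (real \<Rightarrow> 'a \<Rightarrow> real^'n::finite) \<Rightarrow> real \<Rightarrow> 'a measure" where
  "brownian_filtration M B t =
     sigma (space M)
       ({B s -` C \<inter> space M | s C. 0 \<le> s \<and> s \<le> t \<and> C \<in> sets borel} \<union> null_sets M)"

definition extended_stopping_time ::
    "'a measure \<Rightarrow> (real \<Rightarrow> 'a measure) \<Rightarrow> ('a \<Rightarrow> ereal) \<Rightarrow> bool" where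
  "extended_stopping_time M F \<eta> \<longleftrightarrow> (\<forall>t\<ge>0. {\<omega>\<in>space M. \<eta> \<omega> \<le> ereal t} \<in> sets (F t))"


section \<open>Integrals with values in a normed space given by a carrier and a norm\<close>

text \<open>The Sobolev spaces depend on a real parameter and hence are sets, not types.  A space is
  therefore passed as a carrier \<^term>\<open>V\<close> inside a real vector space with a function \<^term>\<open>nrm\<close>
  that is a (complete) norm on \<^term>\<open>V\<close>; for the real line take \<^term>\<open>UNIV\<close> and
  \<^term>\<open>norm\<close>.\<close>

subsection \<open>Bochner integral over a compact time interval\<close>

type_synonym 'v step_fun = "(real set \<times> 'v) list"

definition step_fun_val :: "'v::real_vector step_fun \<Rightarrow> real \<Rightarrow> 'v" where
  "step_fun_val g s = (\<Sum>(A, v)\<leftarrow>g. indicator A s *\<^sub>R v)"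

definition step_fun_integral :: "real \<Rightarrow> 'v::real_vector step_fun \<Rightarrow> 'v" where
  "step_fun_integral t g = (\<Sum>(A, v)\<leftarrow>g. measure lborel (A \<inter> {0..t}) *\<^sub>R v)"

definition has_bochner_integral_upto ::
    "'v::real_vector set \<Rightarrow> ('v \<Rightarrow> real) \<Rightarrow> real \<Rightarrow> (real \<Rightarrow> 'v) \<Rightarrow> 'v \<Rightarrow> bool" where
  "has_bochner_integral_upto V nrm t h u \<longleftrightarrow>
     u \<in> V \<and> (\<forall>s\<in>{0..t}. h s \<in> V) \<and>
     (\<exists>g. (\<forall>n. \<forall>(A, v)\<in>set (g n). A \<in> sets borel \<and> v \<in> V) \<and>
          (\<forall>n. set_integrable lborel {0..t} (\<lambda>s. nrm (h s - step_fun_val (g n) s))) \<and>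
          (\<lambda>n. LBINT s:{0..t}. nrm (h s - step_fun_val (g n) s)) \<longlonglongrightarrow> 0 \<and>
          (\<lambda>n. nrm (u - step_fun_integral t (g n))) \<longlonglongrightarrow> 0)"

subsection \<open>It\^o integral on a stochastic interval\<close>

text \<open>An entry \<open>(r, u, \<xi>, v)\<close> stands for the process \<open>\<xi> 1\<^bsub>(r, u]\<^esub> v\<close>.\<close>

type_synonym ('a, 'v) simple_process = "(real \<times> real \<times> ('a \<Rightarrow> real) \<times> 'v) list"

definition simple_process ::
    "'v set \<Rightarrow> 'a measure \<Rightarrow> (real \<Rightarrow> 'a measure) \<Rightarrow> ('a, 'v) simple_process \<Rightarrow> bool" where
  "simple_process V M F G \<longleftrightarrow>
     (\<forall>(r, u, \<xi>, v)\<in>set G. 0 \<le> r \<and> r \<le> u \<and> \<xi> \<in> borel_measurable (F r) \<and>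
        bounded (\<xi> ` space M) \<and> v \<in> V)"

definition simple_process_val ::
    "('a, 'v::real_vector) simple_process \<Rightarrow> real \<Rightarrow> 'a \<Rightarrow> 'v" where
  "simple_process_val G t \<omega> = (\<Sum>(r, u, \<xi>, v)\<leftarrow>G. (\<xi> \<omega> * indicator {r<..u} t) *\<^sub>R v)"

definition simple_process_integral ::
    "(real \<Rightarrow> 'a \<Rightarrow> real) \<Rightarrow> ('a, 'v::real_vector) simple_process \<Rightarrow> real \<Rightarrow> 'a \<Rightarrow> 'v" where
  "simple_process_integral W G t \<omega> =
     (\<Sum>(r, u, \<xi>, v)\<leftarrow>G. (\<xi> \<omega> * (W (min u t) \<omega> - W (min r t) \<omega>)) *\<^sub>R v)"

text \<open>\<open>has_ito_integral V nrm M F W \<eta> H I\<close>: the process \<open>I\<close> is (a version of)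
  \<open>\<integral>\<^sub>0\<^sup>t H dW\<close> for \<open>0 \<le> t < \<eta>\<close>.  This is the usual extension of the integral from simple
  processes: \<open>H\<close> is approximated in \<open>L\<^sup>2(0, T)\<close> and the integrals converge uniformly on
  \<open>[0, T]\<close>, for every \<open>T < \<eta>\<close>.  Convergence in probability is replaced by almost sure convergence,
  which amounts to passing to a subsequence.  For a Brownian motion \<open>W\<close> and a Hilbert space the
  process \<open>I\<close> is unique up to indistinguishability on \<open>[0, \<eta>)\<close> and has continuous paths there, and
  on that interval \<open>H\<close> agrees almost everywhere with a predictable process that is locally square
  integrable in time.\<close>

definition has_ito_integral ::
    "'v::real_vector set \<Rightarrow> ('v \<Rightarrow> real) \<Rightarrow> 'a measure \<Rightarrow> (real \<Rightarrow> 'a measure) \<Rightarrow>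
     (real \<Rightarrow> 'a \<Rightarrow> real) \<Rightarrow> ('a \<Rightarrow> ereal) \<Rightarrow> (real \<Rightarrow> 'a \<Rightarrow> 'v) \<Rightarrow> (real \<Rightarrow> 'a \<Rightarrow> 'v) \<Rightarrow> bool" where
  "has_ito_integral V nrm M F W \<eta> H I \<longleftrightarrow>
     (\<exists>G. (\<forall>n. simple_process V M F (G n)) \<and>
       (AE \<omega> in M. \<forall>T. 0 \<le> T \<and> ereal T < \<eta> \<omega> \<longrightarrow>
          (\<forall>s\<in>{0..T}. H s \<omega> \<in> V \<and> I s \<omega> \<in> V) \<and>
          (\<forall>n. set_integrable lborel {0..T}
                 (\<lambda>s. (nrm (H s \<omega> - simple_process_val (G n) s \<omega>))\<^sup>2)) \<and>
          (\<lambda>n. LBINT s:{0..T}. (nrm (H s \<omega> - simple_process_val (G n) s \<omega>))\<^sup>2) \<longlonglongrightarrow> 0 \<and>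
          uniform_limit {0..T}
            (\<lambda>n s. nrm (I s \<omega> - simple_process_integral W (G n) s \<omega>)) (\<lambda>_. 0) sequentially))"

definition has_matrix_ito_integral ::
    "'a measure \<Rightarrow> (real \<Rightarrow> 'a measure) \<Rightarrow> (real \<Rightarrow> 'a \<Rightarrow> real^'n::finite) \<Rightarrow> ('a \<Rightarrow> ereal) \<Rightarrow>
     (real \<Rightarrow> 'a \<Rightarrow> real^'n^'n) \<Rightarrow> (real \<Rightarrow> 'a \<Rightarrow> real^'n) \<Rightarrow> bool" where
  "has_matrix_ito_integral M F B \<eta> S J \<longleftrightarrow>
     (\<exists>I. (\<forall>i j. has_ito_integral UNIV norm M F (\<lambda>t \<omega>. B t \<omega> $ j) \<eta>
                   (\<lambda>t \<omega>. S t \<omega> $ i $ j) (I i j)) \<and>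
          J = (\<lambda>t \<omega>. \<chi> i. \<Sum>j\<in>UNIV. I i j t \<omega>))"

text \<open>Almost surely \<open>X\<^sub>t = x + \<integral>\<^sub>0\<^sup>t S\<^sub>s \<cdot> dB\<^sub>s + \<integral>\<^sub>0\<^sup>t b\<^sub>s ds\<close> for all \<open>0 \<le> t < \<eta>\<close>.\<close>

definition is_ito_process ::
    "'a measure \<Rightarrow> (real \<Rightarrow> 'a measure) \<Rightarrow> (real \<Rightarrow> 'a \<Rightarrow> real^'n::finite) \<Rightarrow> ('a \<Rightarrow> ereal) \<Rightarrow>
     real^'n \<Rightarrow> (real \<Rightarrow> 'a \<Rightarrow> real^'n^'n) \<Rightarrow> (real \<Rightarrow> 'a \<Rightarrow> real^'n) \<Rightarrow>
     (real \<Rightarrow> 'a \<Rightarrow> real^'n) \<Rightarrow> bool" where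
  "is_ito_process M F B \<eta> x S b X \<longleftrightarrow>
     (\<exists>J. has_matrix_ito_integral M F B \<eta> S J \<and>
       (AE \<omega> in M. \<forall>t. 0 \<le> t \<and> ereal t < \<eta> \<omega> \<longrightarrow>
          set_integrable lborel {0..t} (\<lambda>s. b s \<omega>) \<and>
          X t \<omega> = x + J t \<omega> + (LBINT s:{0..t}. b s \<omega>)))"


section \<open>Strong local solutions\<close>

text \<open>The space \<open>sobolev p\<close> with an isolated point added is encoded by the option type, the
  isolated point being \<^term>\<open>None\<close>.\<close>

definition sobolev_open :: "real \<Rightarrow> 'n::finite tempered set \<Rightarrow> bool" where
  "sobolev_open p U \<longleftrightarrow> U \<subseteq> sobolev p \<and>
     (\<forall>\<phi>\<in>U. \<exists>e>0. \<forall>\<psi>\<in>sobolev p. sobolev_norm p (\<psi> - \<phi>) < e \<longrightarrow> \<psi> \<in> U)"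

definition hat_sobolev_borel :: "real \<Rightarrow> 'n::finite tempered option measure" where
  "hat_sobolev_borel p =
     sigma (insert None (Some ` sobolev p)) (insert {None} {Some ` U | U. sobolev_open p U})"

definition strong_local_solution ::
    "'a measure \<Rightarrow> (real \<Rightarrow> 'a measure) \<Rightarrow> (real \<Rightarrow> 'a \<Rightarrow> real^'n::finite) \<Rightarrow> real \<Rightarrow>
     ('n \<Rightarrow> 'n \<Rightarrow> 'n tempered) \<Rightarrow> ('n \<Rightarrow> 'n tempered) \<Rightarrow> 'n tempered \<Rightarrow>
     (real \<Rightarrow> 'a \<Rightarrow> 'n tempered option) \<Rightarrow> ('a \<Rightarrow> ereal) \<Rightarrow> bool" where
  "strong_local_solution M F B p \<sigma> b y\<^sub>0 Y \<eta> \<longleftrightarrow>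
     y\<^sub>0 \<in> sobolev p \<and>
     (\<forall>\<omega>\<in>space M. 0 < \<eta> \<omega>) \<and>
     extended_stopping_time M (brownian_filtration M B) \<eta> \<and>
     (\<forall>t\<ge>0. Y t \<in> measurable (brownian_filtration M B t) (hat_sobolev_borel p)) \<and>
     (\<forall>\<omega>\<in>space M. \<forall>t\<ge>0.
        (ereal t < \<eta> \<omega> \<longrightarrow>
           Y t \<omega> \<in> Some ` sobolev p \<and>
           ((\<lambda>s. sobolev_norm p (the (Y s \<omega>) - the (Y t \<omega>))) \<longlongrightarrow> 0)
             (at t within {s. 0 \<le> s \<and> ereal s < \<eta> \<omega>})) \<and>
        (\<eta> \<omega> \<le> ereal t \<longrightarrow> Y t \<omega> = None)) \<and>
     (\<exists>J D.
        (\<forall>j. has_ito_integral (sobolev (p - 1)) (sobolev_norm (p - 1)) M F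
               (\<lambda>t \<omega>. B t \<omega> $ j) \<eta> (\<lambda>s \<omega>. op_A p \<sigma> j (the (Y s \<omega>))) (J j)) \<and>
        (AE \<omega> in M. \<forall>t. 0 \<le> t \<and> ereal t < \<eta> \<omega> \<longrightarrow>
           has_bochner_integral_upto (sobolev (p - 1)) (sobolev_norm (p - 1)) t
             (\<lambda>s. op_L p \<sigma> b (the (Y s \<omega>))) (D t \<omega>) \<and>
           Y t \<omega> = Some (y\<^sub>0 + (\<Sum>j\<in>UNIV. J j t \<omega>) + D t \<omega>)))"

end

theory Submission
  imports Defs
begin

text \<open>Since \<open>\<tau>\<^sub>z \<tau>\<^sub>x y = \<tau>\<^bsub>x+z\<^esub> y\<close>, almost surely the coefficients \<open>\<langle>\<sigma>, Y\<^sub>s\<rangle>\<close> and \<open>\<langle>b, Y\<^sub>s\<rangle>\<close>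
  coincide with \<open>\<sigma>_bar (X\<^sub>s)\<close> and \<open>b_bar (X\<^sub>s)\<close> for all \<open>s < \<eta>\<close>.  Both kinds of integral on
  \<open>[0, \<eta>)\<close> depend only on the integrand there, so the equation for \<open>z\<close>, shifted by \<open>x\<close>, is the
  equation for \<open>X\<close>.\<close>

text \<open>The approximating simple processes \<open>G\<close> for \<open>H\<close> also serve
  \<open>H'\<close>: the integrand enters the definition only through its values on
  \<open>{0..T}\<close> with \<open>T < \<eta> \<omega>\<close>. The quantifier over
  \<open>T\<close> stands inside the almost-sure statement, so the union of the two exceptional null
  sets handles all \<open>T\<close> at once.\<close>

lemma has_ito_integral_cong_AE:
  assumes ito: "has_ito_integral V nrm M F W \<eta> H I"
    and eq: "AE \<omega> in M. \<forall>t. 0 \<le> t \<and> ereal t < \<eta> \<omega> \<longrightarrow> H t \<omega> = H' t \<omega>"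
  shows "has_ito_integral V nrm M F W \<eta> H' I"
proof -
  from ito obtain G where G: "\<forall>n. simple_process V M F (G n)"
    and lim: "AE \<omega> in M. \<forall>T. 0 \<le> T \<and> ereal T < \<eta> \<omega> \<longrightarrow>
          (\<forall>s\<in>{0..T}. H s \<omega> \<in> V \<and> I s \<omega> \<in> V) \<and>
          (\<forall>n. set_integrable lborel {0..T}
                 (\<lambda>s. (nrm (H s \<omega> - simple_process_val (G n) s \<omega>))\<^sup>2)) \<and>
          (\<lambda>n. LBINT s:{0..T}. (nrm (H s \<omega> - simple_process_val (G n) s \<omega>))\<^sup>2) \<longlonglongrightarrow> 0 \<and>
          uniform_limit {0..T}
            (\<lambda>n s. nrm (I s \<omega> - simple_process_integral W (G n) s \<omega>)) (\<lambda>_. 0) sequentially"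
    unfolding has_ito_integral_def by blast
  show ?thesis
    unfolding has_ito_integral_def
  proof (intro exI[of _ G] conjI G)
    show "AE \<omega> in M. \<forall>T. 0 \<le> T \<and> ereal T < \<eta> \<omega> \<longrightarrow>
          (\<forall>s\<in>{0..T}. H' s \<omega> \<in> V \<and> I s \<omega> \<in> V) \<and>
          (\<forall>n. set_integrable lborel {0..T}
                 (\<lambda>s. (nrm (H' s \<omega> - simple_process_val (G n) s \<omega>))\<^sup>2)) \<and>
          (\<lambda>n. LBINT s:{0..T}. (nrm (H' s \<omega> - simple_process_val (G n) s \<omega>))\<^sup>2) \<longlonglongrightarrow> 0 \<and>
          uniform_limit {0..T}
            (\<lambda>n s. nrm (I s \<omega> - simple_process_integral W (G n) s \<omega>)) (\<lambda>_. 0) sequentially"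
      using lim eq
    proof eventually_elim
      case (elim \<omega>)
      show ?case
      proof (intro allI impI)
        fix T assume T: "0 \<le> T \<and> ereal T < \<eta> \<omega>"
        \<comment> \<open>From \<open>s \<le> T\<close> and \<open>T < \<eta> \<omega>\<close> the
          two integrands agree at every \<open>s\<close> in \<open>{0..T}\<close>, not just almost
          everywhere; the membership in \<open>V\<close> is required at each such point.\<close>
        have H: "H' s \<omega> = H s \<omega>" if "s \<in> {0..T}" for s
        proof -
          have "ereal s < \<eta> \<omega>" using that T le_less_trans[of "ereal s" "ereal T"] by simp
          then show ?thesis using elim(2) that by simp
        qed
        have "set_integrable lborel {0..T}
                (\<lambda>s. (nrm (H' s \<omega> - simple_process_val (G n) s \<omega>))\<^sup>2) \<longleftrightarrow>
              set_integrable lborel {0..T}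
                (\<lambda>s. (nrm (H s \<omega> - simple_process_val (G n) s \<omega>))\<^sup>2)" for n
          by (intro set_integrable_cong) (simp_all add: H)
        moreover have "(LBINT s:{0..T}. (nrm (H' s \<omega> - simple_process_val (G n) s \<omega>))\<^sup>2) =
            (LBINT s:{0..T}. (nrm (H s \<omega> - simple_process_val (G n) s \<omega>))\<^sup>2)" for n
          by (intro set_lebesgue_integral_cong) (simp_all add: H)
        ultimately show "(\<forall>s\<in>{0..T}. H' s \<omega> \<in> V \<and> I s \<omega> \<in> V) \<and>
          (\<forall>n. set_integrable lborel {0..T}
                 (\<lambda>s. (nrm (H' s \<omega> - simple_process_val (G n) s \<omega>))\<^sup>2)) \<and>
          (\<lambda>n. LBINT s:{0..T}. (nrm (H' s \<omega> - simple_process_val (G n) s \<omega>))\<^sup>2) \<longlonglongrightarrow> 0 \<and>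
          uniform_limit {0..T}
            (\<lambda>n s. nrm (I s \<omega> - simple_process_integral W (G n) s \<omega>)) (\<lambda>_. 0) sequentially"
          using elim(1) T H by simp
      qed
    qed
  qed
qed

lemma has_matrix_ito_integral_cong_AE:
  assumes "has_matrix_ito_integral M F B \<eta> S J"
    and eq: "AE \<omega> in M. \<forall>t. 0 \<le> t \<and> ereal t < \<eta> \<omega> \<longrightarrow> S t \<omega> = S' t \<omega>"
  shows "has_matrix_ito_integral M F B \<eta> S' J"
proof -
  have "AE \<omega> in M. \<forall>t. 0 \<le> t \<and> ereal t < \<eta> \<omega> \<longrightarrow> S t \<omega> $ i $ j = S' t \<omega> $ i $ j" for i j
    using eq by eventually_elim simp
  with assms(1) show ?thesis
    unfolding has_matrix_ito_integral_def by (blast intro: has_ito_integral_cong_AE)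
qed

text \<open>The process \<open>X\<close> and its martingale part \<open>J\<close> stay the same;
  only the integrands are exchanged. The new ones may therefore be built from the solution itself
  without circularity. The drift is a pathwise integral, so it is compared for each
  \<open>\<omega>\<close> separately.\<close>

lemma is_ito_process_cong_AE:
  assumes "is_ito_process M F B \<eta> x S b X"
    and S: "AE \<omega> in M. \<forall>t. 0 \<le> t \<and> ereal t < \<eta> \<omega> \<longrightarrow> S t \<omega> = S' t \<omega>"
    and b: "AE \<omega> in M. \<forall>t. 0 \<le> t \<and> ereal t < \<eta> \<omega> \<longrightarrow> b t \<omega> = b' t \<omega>"
  shows "is_ito_process M F B \<eta> x S' b' X"
proof -
  from assms(1) obtain J where J: "has_matrix_ito_integral M F B \<eta> S J"
    and X: "AE \<omega> in M. \<forall>t. 0 \<le> t \<and> ereal t < \<eta> \<omega> \<longrightarrow>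
          set_integrable lborel {0..t} (\<lambda>s. b s \<omega>) \<and>
          X t \<omega> = x + J t \<omega> + (LBINT s:{0..t}. b s \<omega>)"
    unfolding is_ito_process_def by blast
  have "AE \<omega> in M. \<forall>t. 0 \<le> t \<and> ereal t < \<eta> \<omega> \<longrightarrow>
          set_integrable lborel {0..t} (\<lambda>s. b' s \<omega>) \<and>
          X t \<omega> = x + J t \<omega> + (LBINT s:{0..t}. b' s \<omega>)"
    using X b
  proof eventually_elim
    case (elim \<omega>)
    show ?case
    proof (intro allI impI)
      fix t assume t: "0 \<le> t \<and> ereal t < \<eta> \<omega>"
      have b': "b' s \<omega> = b s \<omega>" if "s \<in> {0..t}" for s
      proof -
        have "ereal s < \<eta> \<omega>" using that t le_less_trans[of "ereal s" "ereal t"] by simp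
        then show ?thesis using elim(2) that by simp
      qed
      have "set_integrable lborel {0..t} (\<lambda>s. b' s \<omega>) \<longleftrightarrow>
          set_integrable lborel {0..t} (\<lambda>s. b s \<omega>)"
        by (intro set_integrable_cong) (simp_all add: b')
      moreover have "(LBINT s:{0..t}. b' s \<omega>) = (LBINT s:{0..t}. b s \<omega>)"
        by (intro set_lebesgue_integral_cong) (simp_all add: b')
      ultimately show "set_integrable lborel {0..t} (\<lambda>s. b' s \<omega>) \<and>
          X t \<omega> = x + J t \<omega> + (LBINT s:{0..t}. b' s \<omega>)"
        using elim(1) t by simp
    qed
  qed
  with has_matrix_ito_integral_cong_AE[OF J S] show ?thesis
    unfolding is_ito_process_def by blast
qed

text \<open>The coefficients \<open>S\<close> and \<open>b\<close> are given processes, not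
  functions of the state, so adding a constant changes only the starting point.\<close>

lemma is_ito_process_shift:
  assumes "is_ito_process M F B \<eta> x S b X"
  shows "is_ito_process M F B \<eta> (a + x) S b (\<lambda>t \<omega>. a + X t \<omega>)"
  using assms unfolding is_ito_process_def by (simp add: add.assoc)

theorem corollary3p8:
  fixes M :: "'a measure"
    and F :: "real \<Rightarrow> 'a measure"
    and B :: "real \<Rightarrow> 'a \<Rightarrow> real^'n::finite"
    and p :: real
    and y :: "'n tempered"
    and \<sigma> :: "'n \<Rightarrow> 'n \<Rightarrow> 'n tempered"
    and b :: "'n \<Rightarrow> 'n tempered"
    and x :: "real^'n"
    and \<sigma>_bar :: "real^'n \<Rightarrow> real^'n^'n"
    and b_bar :: "real^'n \<Rightarrow> real^'n"
    and Y :: "real \<Rightarrow> 'a \<Rightarrow> 'n tempered option"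
    and \<eta> :: "'a \<Rightarrow> ereal"
    and z X :: "real \<Rightarrow> 'a \<Rightarrow> real^'n"
  assumes "usual_filtered_prob_space M F"
    and "standard_brownian_motion M F B"
    and "y \<in> sobolev p"
    and "\<And>i j. \<sigma> i j \<in> sobolev (- p)"
    and "\<And>i. b i \<in> sobolev (- p)"
    and "\<And>r. \<sigma>_bar r = (\<chi> i j. duality p (\<sigma> i j) (translate r y))"
    and "\<And>r. b_bar r = (\<chi> i. duality p (b i) (translate r y))"
    and "strong_local_solution M F B p \<sigma> b (translate x y) Y \<eta>"
    and "is_ito_process M F B \<eta> 0
           (\<lambda>s \<omega>. duality_mat p \<sigma> (the (Y s \<omega>))) (\<lambda>s \<omega>. duality_vec p b (the (Y s \<omega>))) z"
    and "AE \<omega> in M. \<forall>t. 0 \<le> t \<and> ereal t < \<eta> \<omega> \<longrightarrow>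
           Y t \<omega> = Some (translate (z t \<omega>) (translate x y))"
    and "\<And>t \<omega>. X t \<omega> = x + z t \<omega>"
  shows "is_ito_process M F B \<eta> x (\<lambda>s \<omega>. \<sigma>_bar (X s \<omega>)) (\<lambda>s \<omega>. b_bar (X s \<omega>)) X"
proof -
  \<comment> \<open>The translations compose to \<open>translate (z t \<omega> + x) y\<close>, and
    the sum in the index is \<open>X t \<omega>\<close>. From time \<open>\<eta>\<close> on
    \<open>Y\<close> is \<open>None\<close>, so the identity is confined to
    \<open>t < \<eta>\<close>.\<close>
  have Y: "AE \<omega> in M. \<forall>t. 0 \<le> t \<and> ereal t < \<eta> \<omega> \<longrightarrow> the (Y t \<omega>) = translate (X t \<omega>) y"
    using assms(10) by eventually_elim (simp add: translate_translate assms(11) add.commute)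
  have "AE \<omega> in M. \<forall>t. 0 \<le> t \<and> ereal t < \<eta> \<omega> \<longrightarrow>
      duality_mat p \<sigma> (the (Y t \<omega>)) = \<sigma>_bar (X t \<omega>)"
    using Y by eventually_elim (simp add: duality_mat_def assms(6))
  moreover have "AE \<omega> in M. \<forall>t. 0 \<le> t \<and> ereal t < \<eta> \<omega> \<longrightarrow>
      duality_vec p b (the (Y t \<omega>)) = b_bar (X t \<omega>)"
    using Y by eventually_elim (simp add: duality_vec_def assms(7))
  \<comment> \<open>An intermediate form: the coefficients are already evaluated along
    \<open>X\<close>, while the integrated process is still \<open>z\<close>, started at 0. The
    shift by \<open>x\<close> then turns \<open>z\<close> into \<open>X\<close>.\<close>
  ultimately have "is_ito_process M F B \<eta> 0
      (\<lambda>s \<omega>. \<sigma>_bar (X s \<omega>)) (\<lambda>s \<omega>. b_bar (X s \<omega>)) z"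
    by (rule is_ito_process_cong_AE[OF assms(9)])
  moreover have "X = (\<lambda>t \<omega>. x + z t \<omega>)"
    by (intro ext) (rule assms(11))
  ultimately show ?thesis
    using is_ito_process_shift[where a = x and x = 0] by fastforce
qed

end
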